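(* The maximum rank oracle (Max) is not polynomially reducible to any of the following: the minimum rank oracle (Min), the rank sum oracle (Sum), and the common independence oracle (CI).
   Context: Let $\mathbf{M}_1=(E,\mathcal{I}_1)$, $\mathbf{M}_2=(E,\mathcal{I}_2)$ be loopless matroids on a common finite ground set $E$ with rank functions $r_1,r_2$. For a queried $X\subseteq E$: Sum returns $r_1(X)+r_2(X)$; Min returns $\min\{r_1(X),r_2(X)\}$; Max returns $\max\{r_1(X),r_2(X)\}$; CI returns ``Yes'' if $X\in\mathcal{I}_1\cap\mathcal{I}_2$ and ``No'' otherwise. An oracle $\mathcal{O}_1$ is polynomially reducible to an oracle $\mathcal{O}_2$ if, for every such pair of matroids, the answer of $\mathcal{O}_1$ to any query can be computed using a number of calls to $\mathcal{O}_2$ bounded by a polynomial in $|E|$ (in particular, the answers of $\mathcal{O}_2$ must determine those of $\mathcal{O}_1$). *)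

theory Defs
  imports Main "HOL-Library.Infinite_Typeclass" "HOL-Computational_Algebra.Polynomial"
begin

locale matroid =
  fixes E :: "'a set" and \<I> :: "'a set set"
  assumes finite_ground: "finite E"
    and indep_subset_ground: "X \<in> \<I> \<Longrightarrow> X \<subseteq> E"
    and indep_empty: "{} \<in> \<I>"
    and indep_subset: "X \<in> \<I> \<Longrightarrow> Y \<subseteq> X \<Longrightarrow> Y \<in> \<I>"
    and indep_augment:
      "X \<in> \<I> \<Longrightarrow> Y \<in> \<I> \<Longrightarrow> card X < card Y \<Longrightarrow> \<exists>e \<in> Y - X. insert e X \<in> \<I>"

locale loopless_matroid = matroid +
  assumes loopless: "e \<in> E \<Longrightarrow> {e} \<in> \<I>"

definition matroid_rank :: "'a set set \<Rightarrow> 'a set \<Rightarrow> nat" where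
  "matroid_rank \<I> X = Max (card ` {Y \<in> \<I>. Y \<subseteq> X})"

text \<open>Oracles for pairs of matroids on a common ground set: each matroid is given by its family
  of independent sets, the third argument is the queried set.\<close>

type_synonym ('a, 'b) matroid_oracle = "'a set set \<Rightarrow> 'a set set \<Rightarrow> 'a set \<Rightarrow> 'b"

definition sum_oracle :: "('a, nat) matroid_oracle" where
  "sum_oracle \<I>\<^sub>1 \<I>\<^sub>2 X = matroid_rank \<I>\<^sub>1 X + matroid_rank \<I>\<^sub>2 X"

definition min_oracle :: "('a, nat) matroid_oracle" where
  "min_oracle \<I>\<^sub>1 \<I>\<^sub>2 X = min (matroid_rank \<I>\<^sub>1 X) (matroid_rank \<I>\<^sub>2 X)"

definition max_oracle :: "('a, nat) matroid_oracle" where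
  "max_oracle \<I>\<^sub>1 \<I>\<^sub>2 X = max (matroid_rank \<I>\<^sub>1 X) (matroid_rank \<I>\<^sub>2 X)"

definition ci_oracle :: "('a, bool) matroid_oracle" where
  "ci_oracle \<I>\<^sub>1 \<I>\<^sub>2 X \<longleftrightarrow> X \<in> \<I>\<^sub>1 \<inter> \<I>\<^sub>2"

text \<open>A deterministic adaptive computation is a decision tree: every query may depend on the
  answers received so far.  Only queries are counted; the work between two queries is not
  restricted.\<close>

datatype ('a, 'b, 'c) computation =
    Return 'c
  | Query "'a set" "'b \<Rightarrow> ('a, 'b, 'c) computation"

primrec computation_result :: "('a set \<Rightarrow> 'b) \<Rightarrow> ('a, 'b, 'c) computation \<Rightarrow> 'c" where
  "computation_result f (Return c) = c"
| "computation_result f (Query X k) = computation_result f (k (f X))"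

primrec computation_queries :: "('a set \<Rightarrow> 'b) \<Rightarrow> ('a, 'b, 'c) computation \<Rightarrow> 'a set list" where
  "computation_queries f (Return c) = []"
| "computation_queries f (Query X k) = X # computation_queries f (k (f X))"

text \<open>The algorithm \<open>A\<close> knows the ground set \<open>E\<close> and the set \<open>X\<close> for which the answer of \<open>\<O>\<^sub>1\<close> is
  wanted, but it has access to the two matroids only through \<open>\<O>\<^sub>2\<close>.  The type of elements is
  infinite so that ground sets of every finite size occur.\<close>

definition polynomially_reducible ::
    "('a::infinite, 'c) matroid_oracle \<Rightarrow> ('a, 'b) matroid_oracle \<Rightarrow> bool" where
  "polynomially_reducible \<O>\<^sub>1 \<O>\<^sub>2 \<longleftrightarrow>
    (\<exists>(p :: nat poly) (A :: 'a set \<Rightarrow> 'a set \<Rightarrow> ('a, 'b, 'c) computation).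
      \<forall>E \<I>\<^sub>1 \<I>\<^sub>2 X. loopless_matroid E \<I>\<^sub>1 \<longrightarrow> loopless_matroid E \<I>\<^sub>2 \<longrightarrow> X \<subseteq> E \<longrightarrow>
        computation_result (\<O>\<^sub>2 \<I>\<^sub>1 \<I>\<^sub>2) (A E X) = \<O>\<^sub>1 \<I>\<^sub>1 \<I>\<^sub>2 X \<and>
        set (computation_queries (\<O>\<^sub>2 \<I>\<^sub>1 \<I>\<^sub>2) (A E X)) \<subseteq> Pow E \<and>
        length (computation_queries (\<O>\<^sub>2 \<I>\<^sub>1 \<I>\<^sub>2) (A E X)) \<le> poly p (card E))"

end

theory Submission
  imports Defs
begin

text \<open>In each case the answers of the weaker oracle do not even determine those of Max, whatever
  the number of queries. If \<open>\<I> \<subseteq> \<J>\<close>, then \<open>(\<I>, \<I>)\<close> and \<open>(\<I>, \<J>)\<close> have the same minimum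
  ranks and the same common independent sets, but the maximum ranks are those of \<open>\<I>\<close> and of \<open>\<J>\<close>.
  Rank sums do not change when two matroids trade a direct summand, but the maximum may: for
  disjoint two-element sets \<open>A\<close> and \<open>B\<close>, the sums \<open>U\<^sub>1(A) \<oplus> U\<^sub>1(B)\<close> and \<open>U\<^sub>2(A) \<oplus> U\<^sub>2(B)\<close> of
  uniform matroids have ranks 2 and 4, whereas \<open>U\<^sub>1(A) \<oplus> U\<^sub>2(B)\<close> and \<open>U\<^sub>2(A) \<oplus> U\<^sub>1(B)\<close> both
  have rank 3.\<close>

lemma not_polynomially_reducibleI:
  assumes "loopless_matroid E \<I>\<^sub>1" "loopless_matroid E \<I>\<^sub>2"
    and "loopless_matroid E \<J>\<^sub>1" "loopless_matroid E \<J>\<^sub>2"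
    and "X \<subseteq> E"
    and same_answers: "\<O>\<^sub>2 \<I>\<^sub>1 \<I>\<^sub>2 = \<O>\<^sub>2 \<J>\<^sub>1 \<J>\<^sub>2"
    and different_answers: "\<O>\<^sub>1 \<I>\<^sub>1 \<I>\<^sub>2 X \<noteq> \<O>\<^sub>1 \<J>\<^sub>1 \<J>\<^sub>2 X"
  shows "\<not> polynomially_reducible \<O>\<^sub>1 \<O>\<^sub>2"
proof
  assume "polynomially_reducible \<O>\<^sub>1 \<O>\<^sub>2"
  then obtain A where correct:
    "\<And>E \<K>\<^sub>1 \<K>\<^sub>2 X. \<lbrakk>loopless_matroid E \<K>\<^sub>1; loopless_matroid E \<K>\<^sub>2; X \<subseteq> E\<rbrakk> \<Longrightarrow>
      computation_result (\<O>\<^sub>2 \<K>\<^sub>1 \<K>\<^sub>2) (A E X) = \<O>\<^sub>1 \<K>\<^sub>1 \<K>\<^sub>2 X"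
    unfolding polynomially_reducible_def by metis
  have "\<O>\<^sub>1 \<I>\<^sub>1 \<I>\<^sub>2 X = computation_result (\<O>\<^sub>2 \<I>\<^sub>1 \<I>\<^sub>2) (A E X)"
    using assms(1,2,5) by (rule correct[symmetric])
  also have "\<dots> = computation_result (\<O>\<^sub>2 \<J>\<^sub>1 \<J>\<^sub>2) (A E X)"
    by (simp only: same_answers)
  also have "\<dots> = \<O>\<^sub>1 \<J>\<^sub>1 \<J>\<^sub>2 X"
    using assms(3,4,5) by (rule correct)
  finally show False
    using different_answers by contradiction
qed

context matroid
begin

lemma finite_indep: "X \<in> \<I> \<Longrightarrow> finite X"
  using finite_ground indep_subset_ground finite_subset by blast

lemma finite_indep_subsets: "finite {Y \<in> \<I>. Y \<subseteq> X}"
  by (rule finite_subset[of _ "Pow E"]) (use finite_ground indep_subset_ground in auto)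

lemma card_le_matroid_rank:
  assumes "Y \<in> \<I>" "Y \<subseteq> X"
  shows "card Y \<le> matroid_rank \<I> X"
  unfolding matroid_rank_def using assms finite_indep_subsets by (intro Max_ge) auto

lemma obtain_rank_attaining_indep:
  obtains Y where "Y \<in> \<I>" "Y \<subseteq> X" "card Y = matroid_rank \<I> X"
proof -
  have "matroid_rank \<I> X \<in> card ` {Y \<in> \<I>. Y \<subseteq> X}"
    unfolding matroid_rank_def using finite_indep_subsets indep_empty by (intro Max_in) auto
  then show thesis
    using that by auto
qed

end

lemma matroid_rank_mono:
  assumes "matroid E \<I>" "matroid F \<J>" "\<I> \<subseteq> \<J>"
  shows "matroid_rank \<I> X \<le> matroid_rank \<J> X"
proof -
  obtain Y where "Y \<in> \<I>" "Y \<subseteq> X" "card Y = matroid_rank \<I> X"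
    using matroid.obtain_rank_attaining_indep[OF assms(1)] .
  then show ?thesis
    using matroid.card_le_matroid_rank[OF assms(2), of Y X] assms(3) by auto
qed

definition uniform_indep :: "nat \<Rightarrow> 'a set \<Rightarrow> 'a set set" where
  "uniform_indep k E = {X. X \<subseteq> E \<and> card X \<le> k}"

lemma uniform_indep_mono: "k \<le> l \<Longrightarrow> uniform_indep k E \<subseteq> uniform_indep l E"
  by (auto simp: uniform_indep_def)

lemma matroid_uniform_indep:
  assumes "finite E"
  shows "matroid E (uniform_indep k E)"
proof
  fix X Y
  assume X: "X \<in> uniform_indep k E" and Y: "Y \<in> uniform_indep k E" and less: "card X < card Y"
  have "finite X"
    using X assms by (auto simp: uniform_indep_def intro: finite_subset)
  then have "\<not> Y \<subseteq> X"
    using less card_mono leD by blast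
  then obtain e where "e \<in> Y - X"
    by blast
  moreover from this have "insert e X \<in> uniform_indep k E"
    using X Y less \<open>finite X\<close> by (auto simp: uniform_indep_def)
  ultimately show "\<exists>e \<in> Y - X. insert e X \<in> uniform_indep k E" ..
next
  fix X Y
  assume "X \<in> uniform_indep k E" "Y \<subseteq> X"
  moreover from this have "finite X"
    using assms by (auto simp: uniform_indep_def intro: finite_subset)
  moreover from this have "card Y \<le> card X"
    using \<open>Y \<subseteq> X\<close> by (rule card_mono)
  ultimately show "Y \<in> uniform_indep k E"
    by (auto simp: uniform_indep_def)
qed (use assms in \<open>auto simp: uniform_indep_def\<close>)

lemma loopless_matroid_uniform_indep:
  assumes "finite E" "0 < k"
  shows "loopless_matroid E (uniform_indep k E)"
proof -
  interpret matroid E "uniform_indep k E"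
    using assms(1) by (rule matroid_uniform_indep)
  show ?thesis
    using assms(2) by unfold_locales (auto simp: uniform_indep_def)
qed

lemma matroid_rank_uniform_indep:
  assumes "finite E"
  shows "matroid_rank (uniform_indep k E) X = min k (card (X \<inter> E))"
proof (rule antisym)
  interpret matroid E "uniform_indep k E"
    using assms by (rule matroid_uniform_indep)
  obtain Y where Y: "Y \<in> uniform_indep k E" "Y \<subseteq> X" "card Y = matroid_rank (uniform_indep k E) X"
    by (rule obtain_rank_attaining_indep)
  then have "card Y \<le> card (X \<inter> E)"
    using assms by (intro card_mono) (auto simp: uniform_indep_def)
  with Y show "matroid_rank (uniform_indep k E) X \<le> min k (card (X \<inter> E))"
    by (simp add: uniform_indep_def)
  obtain Z where "Z \<subseteq> X \<inter> E" "card Z = min k (card (X \<inter> E))"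
    by (rule obtain_subset_with_card_n[OF min.cobounded2])
  then show "min k (card (X \<inter> E)) \<le> matroid_rank (uniform_indep k E) X"
    using card_le_matroid_rank[of Z X] by (simp add: uniform_indep_def)
qed

definition direct_sum :: "'a set set \<Rightarrow> 'a set set \<Rightarrow> 'a set set" (infixl "\<oplus>" 65) where
  "\<I> \<oplus> \<J> = {X \<union> Y | X Y. X \<in> \<I> \<and> Y \<in> \<J>}"

lemma direct_sumI: "X \<in> \<I> \<Longrightarrow> Y \<in> \<J> \<Longrightarrow> X \<union> Y \<in> \<I> \<oplus> \<J>"
  by (auto simp: direct_sum_def)

lemma direct_sumE:
  assumes "Z \<in> \<I> \<oplus> \<J>"
  obtains X Y where "Z = X \<union> Y" "X \<in> \<I>" "Y \<in> \<J>"
  using assms by (auto simp: direct_sum_def)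

lemma direct_sum_commute: "\<I> \<oplus> \<J> = \<J> \<oplus> \<I>"
  by (auto simp: direct_sum_def)

lemma card_Un_indep:
  assumes "matroid E \<I>" "matroid F \<J>" "E \<inter> F = {}" "X \<in> \<I>" "Y \<in> \<J>"
  shows "card (X \<union> Y) = card X + card Y"
proof (rule card_Un_disjoint)
  show "X \<inter> Y = {}"
    using assms matroid.indep_subset_ground by blast
qed (use assms in \<open>auto intro: matroid.finite_indep\<close>)

lemma direct_sum_augment_left:
  assumes "matroid E \<I>" "matroid F \<J>" "E \<inter> F = {}"
    and "X \<in> \<I>" "X' \<in> \<J>" "Y \<in> \<I>" "card X < card Y"
  shows "\<exists>e \<in> Y - (X \<union> X'). insert e (X \<union> X') \<in> \<I> \<oplus> \<J>"
proof -
  obtain e where e: "e \<in> Y - X" "insert e X \<in> \<I>"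
    using matroid.indep_augment[OF assms(1)] assms by blast
  then have "e \<notin> X'"
    using assms matroid.indep_subset_ground by blast
  moreover have "insert e (X \<union> X') \<in> \<I> \<oplus> \<J>"
    using direct_sumI[OF e(2) \<open>X' \<in> \<J>\<close>] by simp
  ultimately show ?thesis
    using e(1) by blast
qed

lemma direct_sum_augment:
  assumes "matroid E \<I>" "matroid F \<J>" "E \<inter> F = {}"
    and "Z \<in> \<I> \<oplus> \<J>" "W \<in> \<I> \<oplus> \<J>" "card Z < card W"
  shows "\<exists>e \<in> W - Z. insert e Z \<in> \<I> \<oplus> \<J>"
proof -
  obtain X X' where Z: "Z = X \<union> X'" "X \<in> \<I>" "X' \<in> \<J>"
    using assms(4) by (rule direct_sumE)
  obtain Y Y' where W: "W = Y \<union> Y'" "Y \<in> \<I>" "Y' \<in> \<J>"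
    using assms(5) by (rule direct_sumE)
  have "card X + card X' < card Y + card Y'"
    using \<open>card Z < card W\<close> Z W by (simp add: card_Un_indep[OF assms(1-3)])
  then consider (left) "card X < card Y" | (right) "card X' < card Y'"
    by linarith
  then show ?thesis
  proof cases
    case left
    then have "\<exists>e \<in> Y - (X \<union> X'). insert e (X \<union> X') \<in> \<I> \<oplus> \<J>"
      by (rule direct_sum_augment_left[OF assms(1-3) Z(2,3) W(2)])
    then show ?thesis
      unfolding Z(1) W(1) by blast
  next
    case right
    have "F \<inter> E = {}"
      using assms(3) by blast
    from right have "\<exists>e \<in> Y' - (X' \<union> X). insert e (X' \<union> X) \<in> \<J> \<oplus> \<I>"
      by (rule direct_sum_augment_left[OF assms(2,1) \<open>F \<inter> E = {}\<close> Z(3,2) W(3)])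
    then show ?thesis
      unfolding Z(1) W(1) direct_sum_commute[of \<I>] Un_commute[of X] by blast
  qed
qed

lemma matroid_direct_sum:
  assumes "matroid E \<I>" "matroid F \<J>" "E \<inter> F = {}"
  shows "matroid (E \<union> F) (\<I> \<oplus> \<J>)"
proof -
  interpret M: matroid E \<I> by fact
  interpret N: matroid F \<J> by fact
  show ?thesis
  proof
    show "finite (E \<union> F)"
      using M.finite_ground N.finite_ground by simp
    show "{} \<in> \<I> \<oplus> \<J>"
      using direct_sumI[OF M.indep_empty N.indep_empty] by simp
    show "Z \<subseteq> E \<union> F" if "Z \<in> \<I> \<oplus> \<J>" for Z
      using that M.indep_subset_ground N.indep_subset_ground by (elim direct_sumE) blast
  next
    fix Z W
    assume "Z \<in> \<I> \<oplus> \<J>" and subset: "W \<subseteq> Z"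
    then obtain X Y where Z: "Z = X \<union> Y" "X \<in> \<I>" "Y \<in> \<J>"
      by (elim direct_sumE)
    have "W \<inter> X \<union> W \<inter> Y \<in> \<I> \<oplus> \<J>"
      using M.indep_subset[OF Z(2)] N.indep_subset[OF Z(3)] by (intro direct_sumI) auto
    also have "W \<inter> X \<union> W \<inter> Y = W"
      using subset Z(1) by blast
    finally show "W \<in> \<I> \<oplus> \<J>" .
  qed (rule direct_sum_augment[OF assms])
qed

lemma loopless_matroid_direct_sum:
  assumes "loopless_matroid E \<I>" "loopless_matroid F \<J>" "E \<inter> F = {}"
  shows "loopless_matroid (E \<union> F) (\<I> \<oplus> \<J>)"
proof -
  interpret M: loopless_matroid E \<I> by fact
  interpret N: loopless_matroid F \<J> by fact
  interpret matroid "E \<union> F" "\<I> \<oplus> \<J>"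
    using M.matroid_axioms N.matroid_axioms assms(3) by (rule matroid_direct_sum)
  show ?thesis
  proof
    fix e
    assume "e \<in> E \<union> F"
    then show "{e} \<in> \<I> \<oplus> \<J>"
      using direct_sumI[OF M.loopless N.indep_empty] direct_sumI[OF M.indep_empty N.loopless]
      by auto
  qed
qed

lemma matroid_rank_direct_sum:
  assumes "matroid E \<I>" "matroid F \<J>" "E \<inter> F = {}"
  shows "matroid_rank (\<I> \<oplus> \<J>) X = matroid_rank \<I> X + matroid_rank \<J> X"
proof (rule antisym)
  interpret M: matroid E \<I> by fact
  interpret N: matroid F \<J> by fact
  interpret S: matroid "E \<union> F" "\<I> \<oplus> \<J>"
    using assms by (rule matroid_direct_sum)
  obtain Z where Z: "Z \<in> \<I> \<oplus> \<J>" "Z \<subseteq> X" "card Z = matroid_rank (\<I> \<oplus> \<J>) X"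
    by (rule S.obtain_rank_attaining_indep)
  then obtain Y Y' where Y: "Z = Y \<union> Y'" "Y \<in> \<I>" "Y' \<in> \<J>"
    by (elim direct_sumE)
  then have "card Z = card Y + card Y'"
    by (simp add: card_Un_indep[OF assms])
  also have "\<dots> \<le> matroid_rank \<I> X + matroid_rank \<J> X"
    using Y Z(2) by (intro add_mono M.card_le_matroid_rank N.card_le_matroid_rank) auto
  finally show "matroid_rank (\<I> \<oplus> \<J>) X \<le> matroid_rank \<I> X + matroid_rank \<J> X"
    using Z(3) by simp
next
  obtain Y where Y: "Y \<in> \<I>" "Y \<subseteq> X" "card Y = matroid_rank \<I> X"
    using matroid.obtain_rank_attaining_indep[OF assms(1)] .
  obtain Y' where Y': "Y' \<in> \<J>" "Y' \<subseteq> X" "card Y' = matroid_rank \<J> X"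
    using matroid.obtain_rank_attaining_indep[OF assms(2)] .
  have "matroid_rank \<I> X + matroid_rank \<J> X = card (Y \<union> Y')"
    using Y Y' by (simp add: card_Un_indep[OF assms])
  also have "\<dots> \<le> matroid_rank (\<I> \<oplus> \<J>) X"
    using Y Y'
    by (intro matroid.card_le_matroid_rank[OF matroid_direct_sum[OF assms]] direct_sumI) auto
  finally show "matroid_rank \<I> X + matroid_rank \<J> X \<le> matroid_rank (\<I> \<oplus> \<J>) X" .
qed

lemma min_oracle_subset:
  assumes "matroid E \<I>" "matroid F \<J>" "\<I> \<subseteq> \<J>"
  shows "min_oracle \<I> \<J> = matroid_rank \<I>"
  using matroid_rank_mono[OF assms] by (simp add: fun_eq_iff min_oracle_def)

lemma ci_oracle_subset:
  assumes "\<I> \<subseteq> \<J>"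
  shows "ci_oracle \<I> \<J> = (\<lambda>X. X \<in> \<I>)"
  using assms by (auto simp: fun_eq_iff ci_oracle_def)

lemma sum_oracle_direct_sum_swap:
  assumes "matroid E \<I>\<^sub>1" "matroid E \<I>\<^sub>2" "matroid F \<J>\<^sub>1" "matroid F \<J>\<^sub>2" "E \<inter> F = {}"
  shows "sum_oracle (\<I>\<^sub>1 \<oplus> \<J>\<^sub>1) (\<I>\<^sub>2 \<oplus> \<J>\<^sub>2) = sum_oracle (\<I>\<^sub>1 \<oplus> \<J>\<^sub>2) (\<I>\<^sub>2 \<oplus> \<J>\<^sub>1)"
  using assms by (simp add: fun_eq_iff sum_oracle_def matroid_rank_direct_sum)

lemma not_polynomially_reducible_max_if_nested_pairs_agree:
  fixes \<O> :: "('a::infinite, 'b) matroid_oracle"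
  assumes same_answers: "\<And>E \<I> \<J>. \<lbrakk>matroid E \<I>; matroid E \<J>; \<I> \<subseteq> \<J>\<rbrakk> \<Longrightarrow> \<O> \<I> \<I> = \<O> \<I> \<J>"
  shows "\<not> polynomially_reducible (max_oracle :: ('a, nat) matroid_oracle) \<O>"
proof -
  obtain A :: "'a set" where A: "finite A" "card A = 2"
    using infinite_arbitrarily_large[OF infinite_UNIV] by blast
  have subset: "uniform_indep 1 A \<subseteq> uniform_indep 2 A"
    by (simp add: uniform_indep_mono)
  show ?thesis
  proof (rule not_polynomially_reducibleI[where E = A and X = A])
    show "\<O> (uniform_indep 1 A) (uniform_indep 1 A) = \<O> (uniform_indep 1 A) (uniform_indep 2 A)"
      using same_answers matroid_uniform_indep[OF A(1)] subset by blast
    show "max_oracle (uniform_indep 1 A) (uniform_indep 1 A) A \<noteq>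
        max_oracle (uniform_indep 1 A) (uniform_indep 2 A) A"
      using A by (simp add: max_oracle_def matroid_rank_uniform_indep)
  qed (simp_all add: A loopless_matroid_uniform_indep)
qed

lemma not_polynomially_reducible_max_min:
  "\<not> polynomially_reducible (max_oracle :: ('a::infinite, nat) matroid_oracle) min_oracle"
  by (rule not_polynomially_reducible_max_if_nested_pairs_agree) (simp add: min_oracle_subset)

lemma not_polynomially_reducible_max_ci:
  "\<not> polynomially_reducible (max_oracle :: ('a::infinite, nat) matroid_oracle) ci_oracle"
  by (rule not_polynomially_reducible_max_if_nested_pairs_agree) (simp add: ci_oracle_subset)

lemma not_polynomially_reducible_max_sum:
  "\<not> polynomially_reducible (max_oracle :: ('a::infinite, nat) matroid_oracle) sum_oracle"
proof -
  obtain A :: "'a set" where A: "finite A" "card A = 2"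
    using infinite_arbitrarily_large[OF infinite_UNIV] by blast
  then have "infinite (- A)"
    by (simp add: infinite_UNIV)
  then obtain B where B: "finite B" "card B = 2" "B \<subseteq> - A"
    using infinite_arbitrarily_large by blast
  have disjoint: "A \<inter> B = {}"
    using B(3) by blast
  let ?U = uniform_indep
  have matroid: "matroid A (?U k A)" "matroid B (?U k B)" for k
    using A B by (simp_all add: matroid_uniform_indep)
  have loopless: "loopless_matroid (A \<union> B) (?U k A \<oplus> ?U l B)" if "0 < k" "0 < l" for k l
    using that A B disjoint by (simp add: loopless_matroid_direct_sum loopless_matroid_uniform_indep)
  have rank: "matroid_rank (?U k A \<oplus> ?U l B) (A \<union> B) = min k 2 + min l 2" for k l
    using A B
    by (simp add: matroid_rank_direct_sum[OF matroid disjoint] matroid_rank_uniform_indep Int_absorb1)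
  show ?thesis
  proof (rule not_polynomially_reducibleI[where E = "A \<union> B" and X = "A \<union> B"])
    show "sum_oracle (?U 1 A \<oplus> ?U 1 B) (?U 2 A \<oplus> ?U 2 B) =
        sum_oracle (?U 1 A \<oplus> ?U 2 B) (?U 2 A \<oplus> ?U 1 B)"
      using matroid disjoint by (intro sum_oracle_direct_sum_swap)
    show "max_oracle (?U 1 A \<oplus> ?U 1 B) (?U 2 A \<oplus> ?U 2 B) (A \<union> B) \<noteq>
        max_oracle (?U 1 A \<oplus> ?U 2 B) (?U 2 A \<oplus> ?U 1 B) (A \<union> B)"
      by (simp add: max_oracle_def rank)
  qed (simp_all add: loopless)
qed

theorem theorem3p4:
  shows "\<not> polynomially_reducible (max_oracle :: ('a::infinite, nat) matroid_oracle) (min_oracle :: ('a, nat) matroid_oracle) \<and>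
         \<not> polynomially_reducible (max_oracle :: ('a, nat) matroid_oracle) (sum_oracle :: ('a, nat) matroid_oracle) \<and>
         \<not> polynomially_reducible (max_oracle :: ('a, nat) matroid_oracle) (ci_oracle :: ('a, bool) matroid_oracle)"
  using not_polynomially_reducible_max_min not_polynomially_reducible_max_sum
    not_polynomially_reducible_max_ci
  by blast

end
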